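(* Let $\{A,G,\sigma,\alpha\}$ be a crossed system. The commutant of $A$ in $A \rtimes_{\alpha}^{\sigma} G$ is the collection of elements $\sum_{s \in G} a_s u_s$ in $A \rtimes_{\alpha}^{\sigma} G$ satisfying both: $a_s = 0$ for all $s \in G$ with $d(s) \neq c(s)$; and $a_s \sigma_s(a) = a a_s$ for all $s \in G$ with $d(s)=c(s)$ and all $a \in A_{d(s)}$.
   Context: Rings are associative and unital; ring homomorphisms preserve multiplicative identities. $G$ is a small category; an object is identified with its identity morphism; $s \in G$ means that $s$ is a morphism of $G$; $d(s)$ and $c(s)$ are the domain and codomain of $s$; $G^{(2)}$ is the set of pairs $(s,t)$ of morphisms with $d(s)=c(t)$ (so that $st$ is defined), and $G^{(3)}$ is the set of triples $(s,t,r)$ with $(s,t),(t,r)\in G^{(2)}$. A crossed system is a quadruple $\{A,G,\sigma,\alpha\}$ where $A$ is the direct sum of rings $A_e$, $e\in ob(G)$; $\sigma_s : A_{d(s)}\to A_{c(s)}$, $s\in G$, are ring homomorphisms; and $\alpha$ assigns to each $(s,t)\in G^{(2)}$ an element $\alpha(s,t)\in A_{c(s)}$, such that for all $e\in ob(G)$, all $(s,t,r)\in G^{(3)}$ and all $a\in A_{d(t)}$: $\sigma_e=\mathrm{id}_{A_e}$; $\alpha(s,d(s))=1_{A_{c(s)}}$; $\alpha(c(t),t)=1_{A_{c(t)}}$; $\alpha(s,t)\alpha(st,r)=\sigma_s(\alpha(t,r))\alpha(s,tr)$; $\sigma_s(\sigma_t(a))\alpha(s,t)=\alpha(s,t)\sigma_{st}(a)$.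 The category crossed product $A\rtimes_\alpha^\sigma G$ is the set of formal sums $\sum_{s\in G}a_su_s$ with $a_s\in A_{c(s)}$, all but finitely many zero, with componentwise addition and multiplication given by biadditive extension of $(a_su_s)(b_tu_t)=a_s\sigma_s(b_t)\alpha(s,t)u_{st}$ if $(s,t)\in G^{(2)}$ and $(a_su_s)(b_tu_t)=0$ otherwise. It is associative but need not have a multiplicative identity when $ob(G)$ is infinite. The ring $A$ is identified with the coefficient ring $\oplus_{e\in ob(G)}A_eu_e$. The commutant of a subset is the set of all elements commuting with every element of the subset. *)

theory Defs
  imports "HOL-Algebra.Ring"
begin

section \<open>Small categories\<close>

text \<open>Objects are identified with their identity morphisms, so a small category is given by its
  set of morphisms, with domains and codomains being morphisms themselves.\<close>

record 'g category =
  Mor :: "'g set"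
  Dom :: "'g \<Rightarrow> 'g"
  Cod :: "'g \<Rightarrow> 'g"
  Comp :: "'g \<Rightarrow> 'g \<Rightarrow> 'g"

locale small_category =
  fixes G :: "'g category"
  assumes Dom_Mor: "s \<in> Mor G \<Longrightarrow> Dom G s \<in> Mor G"
    and Cod_Mor: "s \<in> Mor G \<Longrightarrow> Cod G s \<in> Mor G"
    and Dom_Dom: "s \<in> Mor G \<Longrightarrow> Dom G (Dom G s) = Dom G s"
    and Cod_Dom: "s \<in> Mor G \<Longrightarrow> Cod G (Dom G s) = Dom G s"
    and Dom_Cod: "s \<in> Mor G \<Longrightarrow> Dom G (Cod G s) = Cod G s"
    and Cod_Cod: "s \<in> Mor G \<Longrightarrow> Cod G (Cod G s) = Cod G s"
    and Comp_Mor: "\<lbrakk>s \<in> Mor G; t \<in> Mor G; Dom G s = Cod G t\<rbrakk> \<Longrightarrow> Comp G s t \<in> Mor G"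
    and Dom_Comp: "\<lbrakk>s \<in> Mor G; t \<in> Mor G; Dom G s = Cod G t\<rbrakk> \<Longrightarrow> Dom G (Comp G s t) = Dom G t"
    and Cod_Comp: "\<lbrakk>s \<in> Mor G; t \<in> Mor G; Dom G s = Cod G t\<rbrakk> \<Longrightarrow> Cod G (Comp G s t) = Cod G s"
    and Comp_Dom: "s \<in> Mor G \<Longrightarrow> Comp G s (Dom G s) = s"
    and Comp_Cod: "s \<in> Mor G \<Longrightarrow> Comp G (Cod G s) s = s"
    and Comp_assoc: "\<lbrakk>s \<in> Mor G; t \<in> Mor G; r \<in> Mor G; Dom G s = Cod G t; Dom G t = Cod G r\<rbrakk>
      \<Longrightarrow> Comp G (Comp G s t) r = Comp G s (Comp G t r)"

definition Ob :: "'g category \<Rightarrow> 'g set" where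
  "Ob G = {e \<in> Mor G. Dom G e = e \<and> Cod G e = e}"

definition composable_pairs :: "'g category \<Rightarrow> ('g \<times> 'g) set" where
  "composable_pairs G = {(s, t). s \<in> Mor G \<and> t \<in> Mor G \<and> Dom G s = Cod G t}"

definition composable_triples :: "'g category \<Rightarrow> ('g \<times> 'g \<times> 'g) set" where
  "composable_triples G = {(s, t, r). (s, t) \<in> composable_pairs G \<and> (t, r) \<in> composable_pairs G}"


section \<open>Crossed systems\<close>

text \<open>The family \<open>A\<close> of coefficient rings matters only at the objects of \<open>G\<close>, the maps
  \<open>\<sigma> s\<close> only on the carrier of \<open>A (Dom G s)\<close>, and \<open>\<alpha>\<close> only at composable pairs.\<close>

locale crossed_system = small_category G
  for A :: "'g \<Rightarrow> 'a ring" and G :: "'g category"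
    and \<sigma> :: "'g \<Rightarrow> 'a \<Rightarrow> 'a" and \<alpha> :: "'g \<Rightarrow> 'g \<Rightarrow> 'a" +
  assumes ring_A: "e \<in> Ob G \<Longrightarrow> ring (A e)"
    and sigma_hom: "s \<in> Mor G \<Longrightarrow> \<sigma> s \<in> ring_hom (A (Dom G s)) (A (Cod G s))"
    and alpha_closed: "(s, t) \<in> composable_pairs G \<Longrightarrow> \<alpha> s t \<in> carrier (A (Cod G s))"
    and sigma_id: "\<lbrakk>e \<in> Ob G; a \<in> carrier (A e)\<rbrakk> \<Longrightarrow> \<sigma> e a = a"
    and alpha_Dom: "s \<in> Mor G \<Longrightarrow> \<alpha> s (Dom G s) = \<one>\<^bsub>A (Cod G s)\<^esub>"
    and alpha_Cod: "t \<in> Mor G \<Longrightarrow> \<alpha> (Cod G t) t = \<one>\<^bsub>A (Cod G t)\<^esub>"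
    and alpha_cocycle: "(s, t, r) \<in> composable_triples G
      \<Longrightarrow> \<alpha> s t \<otimes>\<^bsub>A (Cod G s)\<^esub> \<alpha> (Comp G s t) r
        = \<sigma> s (\<alpha> t r) \<otimes>\<^bsub>A (Cod G s)\<^esub> \<alpha> s (Comp G t r)"
    and sigma_alpha: "\<lbrakk>(s, t) \<in> composable_pairs G; a \<in> carrier (A (Dom G t))\<rbrakk>
      \<Longrightarrow> \<sigma> s (\<sigma> t a) \<otimes>\<^bsub>A (Cod G s)\<^esub> \<alpha> s t = \<alpha> s t \<otimes>\<^bsub>A (Cod G s)\<^esub> \<sigma> (Comp G s t) a"


section \<open>Category crossed products\<close>

text \<open>A formal sum of terms \<open>a\<^sub>s u\<^sub>s\<close> is the function sending each morphism \<open>s\<close> to \<open>a\<^sub>s\<close>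
  (and \<open>undefined\<close> off \<open>Mor G\<close>). The product is biadditive extension written out: its
  coefficient at \<open>r\<close> collects the terms with \<open>st = r\<close>. Restricting the index set to the
  supports makes it finite, as \<^const>\<open>finsum\<close> requires. The crossed product need not be unital;
  the field \<open>one\<close> holds the formal sum of all \<open>u\<^sub>e\<close>, \<open>e \<in> Ob G\<close>, which may lie outside the
  carrier if \<open>Ob G\<close> is infinite.\<close>

definition crossed_product ::
  "('g \<Rightarrow> 'a ring) \<Rightarrow> 'g category \<Rightarrow> ('g \<Rightarrow> 'a \<Rightarrow> 'a) \<Rightarrow> ('g \<Rightarrow> 'g \<Rightarrow> 'a) \<Rightarrow> ('g \<Rightarrow> 'a) ring" where
  "crossed_product A G \<sigma> \<alpha> =
    \<lparr>carrier = {f \<in> \<Pi>\<^sub>E s\<in>Mor G. carrier (A (Cod G s)). finite {s \<in> Mor G. f s \<noteq> \<zero>\<^bsub>A (Cod G s)\<^esub>}},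
     mult = (\<lambda>f g. \<lambda>r\<in>Mor G. finsum (A (Cod G r))
       (\<lambda>(s, t). f s \<otimes>\<^bsub>A (Cod G s)\<^esub> \<sigma> s (g t) \<otimes>\<^bsub>A (Cod G s)\<^esub> \<alpha> s t)
       {(s, t) \<in> composable_pairs G.
         Comp G s t = r \<and> f s \<noteq> \<zero>\<^bsub>A (Cod G s)\<^esub> \<and> g t \<noteq> \<zero>\<^bsub>A (Cod G t)\<^esub>}),
     one = (\<lambda>s\<in>Mor G. if s \<in> Ob G then \<one>\<^bsub>A s\<^esub> else \<zero>\<^bsub>A (Cod G s)\<^esub>),
     zero = (\<lambda>s\<in>Mor G. \<zero>\<^bsub>A (Cod G s)\<^esub>),
     add = (\<lambda>f g. \<lambda>s\<in>Mor G. f s \<oplus>\<^bsub>A (Cod G s)\<^esub> g s)\<rparr>"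

definition monomial :: "('g \<Rightarrow> 'a ring) \<Rightarrow> 'g category \<Rightarrow> 'g \<Rightarrow> 'a \<Rightarrow> 'g \<Rightarrow> 'a" where
  "monomial A G s a = (\<lambda>r\<in>Mor G. if r = s then a else \<zero>\<^bsub>A (Cod G r)\<^esub>)"

text \<open>The copy of \<open>A\<close>, the direct sum of the \<open>A e\<close>, inside the crossed product.\<close>

definition coefficient_ring ::
  "('g \<Rightarrow> 'a ring) \<Rightarrow> 'g category \<Rightarrow> ('g \<Rightarrow> 'a \<Rightarrow> 'a) \<Rightarrow> ('g \<Rightarrow> 'g \<Rightarrow> 'a) \<Rightarrow> ('g \<Rightarrow> 'a) set" where
  "coefficient_ring A G \<sigma> \<alpha> =
    {f \<in> carrier (crossed_product A G \<sigma> \<alpha>). \<forall>s\<in>Mor G. s \<notin> Ob G \<longrightarrow> f s = \<zero>\<^bsub>A (Cod G s)\<^esub>}"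

definition commutant :: "('a, 'm) monoid_scheme \<Rightarrow> 'a set \<Rightarrow> 'a set" where
  "commutant R S = {x \<in> carrier R. \<forall>y\<in>S. x \<otimes>\<^bsub>R\<^esub> y = y \<otimes>\<^bsub>R\<^esub> x}"


section \<open>The product is the biadditive extension of the product of monomials\<close>

context crossed_system
begin

lemma Cod_Ob: "s \<in> Mor G \<Longrightarrow> Cod G s \<in> Ob G"
  by (simp add: Ob_def Cod_Mor Dom_Cod Cod_Cod)

lemma Dom_Ob: "s \<in> Mor G \<Longrightarrow> Dom G s \<in> Ob G"
  by (simp add: Ob_def Dom_Mor Dom_Dom Cod_Dom)

lemma ring_Cod: "s \<in> Mor G \<Longrightarrow> ring (A (Cod G s))"
  by (simp add: Cod_Ob ring_A)

lemma sigma_closed: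
  "\<lbrakk>s \<in> Mor G; a \<in> carrier (A (Dom G s))\<rbrakk> \<Longrightarrow> \<sigma> s a \<in> carrier (A (Cod G s))"
  by (rule ring_hom_closed[OF sigma_hom])

lemma sigma_add:
  "\<lbrakk>s \<in> Mor G; a \<in> carrier (A (Dom G s)); b \<in> carrier (A (Dom G s))\<rbrakk>
    \<Longrightarrow> \<sigma> s (a \<oplus>\<^bsub>A (Dom G s)\<^esub> b) = \<sigma> s a \<oplus>\<^bsub>A (Cod G s)\<^esub> \<sigma> s b"
  by (rule ring_hom_add[OF sigma_hom])

lemma sigma_zero: "s \<in> Mor G \<Longrightarrow> \<sigma> s \<zero>\<^bsub>A (Dom G s)\<^esub> = \<zero>\<^bsub>A (Cod G s)\<^esub>"
  by (simp add: ring_hom_zero[OF sigma_hom] ring_A Dom_Ob Cod_Ob)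

abbreviation "R \<equiv> crossed_product A G \<sigma> \<alpha>"

lemma coeff_closed: "\<lbrakk>f \<in> carrier R; s \<in> Mor G\<rbrakk> \<Longrightarrow> f s \<in> carrier (A (Cod G s))"
  by (auto simp: crossed_product_def)

lemma finite_support: "f \<in> carrier R \<Longrightarrow> finite {s \<in> Mor G. f s \<noteq> \<zero>\<^bsub>A (Cod G s)\<^esub>}"
  by (simp add: crossed_product_def)

lemma term_closed:
  assumes "(s, t) \<in> composable_pairs G" "f \<in> carrier R" "g \<in> carrier R"
  shows "f s \<otimes>\<^bsub>A (Cod G s)\<^esub> \<sigma> s (g t) \<otimes>\<^bsub>A (Cod G s)\<^esub> \<alpha> s t \<in> carrier (A (Cod G s))"
proof -
  have st: "s \<in> Mor G" "t \<in> Mor G" "Dom G s = Cod G t"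
    using assms(1) by (auto simp: composable_pairs_def)
  interpret ring "A (Cod G s)" using ring_Cod st by blast
  show ?thesis
    using coeff_closed[OF assms(2) st(1)] coeff_closed[OF assms(3) st(2)] sigma_closed[OF st(1)]
      alpha_closed[OF assms(1)] st(3) by simp
qed

lemma mult_eval:
  assumes f: "f \<in> carrier R" and g: "g \<in> carrier R" and r: "r \<in> Mor G"
    and S: "finite S" "{s \<in> Mor G. f s \<noteq> \<zero>\<^bsub>A (Cod G s)\<^esub>} \<subseteq> S"
    and T: "finite T" "{t \<in> Mor G. g t \<noteq> \<zero>\<^bsub>A (Cod G t)\<^esub>} \<subseteq> T"
  shows "(f \<otimes>\<^bsub>R\<^esub> g) r = finsum (A (Cod G r))
    (\<lambda>(s, t). f s \<otimes>\<^bsub>A (Cod G s)\<^esub> \<sigma> s (g t) \<otimes>\<^bsub>A (Cod G s)\<^esub> \<alpha> s t)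
    {(s, t) \<in> composable_pairs G. Comp G s t = r \<and> s \<in> S \<and> t \<in> T}"
proof -
  interpret ring "A (Cod G r)" using ring_Cod r by blast
  let ?F = "\<lambda>(s, t). f s \<otimes>\<^bsub>A (Cod G s)\<^esub> \<sigma> s (g t) \<otimes>\<^bsub>A (Cod G s)\<^esub> \<alpha> s t"
  let ?I = "{(s, t) \<in> composable_pairs G.
    Comp G s t = r \<and> f s \<noteq> \<zero>\<^bsub>A (Cod G s)\<^esub> \<and> g t \<noteq> \<zero>\<^bsub>A (Cod G t)\<^esub>}"
  let ?J = "{(s, t) \<in> composable_pairs G. Comp G s t = r \<and> s \<in> S \<and> t \<in> T}"
  have "finsum (A (Cod G r)) ?F ?I = finsum (A (Cod G r)) ?F ?J"
  proof (rule add.finprod_mono_neutral_cong_left)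
    show "finite ?J"
      by (rule finite_subset[of _ "S \<times> T"]) (use S T in auto)
    show "?I \<subseteq> ?J"
      using S(2) T(2) by (auto simp: composable_pairs_def)
    show "?F i = \<zero>\<^bsub>A (Cod G r)\<^esub>" if "i \<in> ?J - ?I" for i
    proof -
      obtain s t where i: "i = (s, t)" by (cases i)
      have st: "(s, t) \<in> composable_pairs G" "s \<in> Mor G" "t \<in> Mor G" "Dom G s = Cod G t"
        "Comp G s t = r" "f s = \<zero>\<^bsub>A (Cod G s)\<^esub> \<or> g t = \<zero>\<^bsub>A (Cod G t)\<^esub>"
        using that i by (auto simp: composable_pairs_def)
      have C: "Cod G s = Cod G r" using Cod_Comp[of s t] st by simp
      have "f s \<in> carrier (A (Cod G r))" "\<sigma> s (g t) \<in> carrier (A (Cod G r))"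
        "\<alpha> s t \<in> carrier (A (Cod G r))"
        using coeff_closed[OF f st(2)] coeff_closed[OF g st(3)] sigma_closed[OF st(2)]
          alpha_closed[OF st(1)] st(4) C by auto
      moreover have "g t = \<zero>\<^bsub>A (Cod G t)\<^esub> \<Longrightarrow> \<sigma> s (g t) = \<zero>\<^bsub>A (Cod G r)\<^esub>"
        using sigma_zero[OF st(2)] st(4) C by simp
      ultimately show ?thesis using st(6) C i by auto
    qed
    show "?F \<in> ?J \<rightarrow> carrier (A (Cod G r))"
    proof
      fix i assume "i \<in> ?J"
      then obtain s t where i: "i = (s, t)" "(s, t) \<in> composable_pairs G" "Comp G s t = r" by auto
      then have "Cod G s = Cod G r" using Cod_Comp[of s t] by (auto simp: composable_pairs_def)
      then show "?F i \<in> carrier (A (Cod G r))" using term_closed[OF i(2) f g] i by simp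
    qed
  qed simp
  then show ?thesis using r by (simp add: crossed_product_def)
qed

lemma add_eval: "r \<in> Mor G \<Longrightarrow> (f \<oplus>\<^bsub>R\<^esub> g) r = f r \<oplus>\<^bsub>A (Cod G r)\<^esub> g r"
  by (simp add: crossed_product_def)

lemma crossed_product_add_closed:
  assumes "f \<in> carrier R" "g \<in> carrier R"
  shows "f \<oplus>\<^bsub>R\<^esub> g \<in> carrier R"
proof -
  have "finite {s \<in> Mor G. (f \<oplus>\<^bsub>R\<^esub> g) s \<noteq> \<zero>\<^bsub>A (Cod G s)\<^esub>}"
  proof (rule finite_subset)
    show "{s \<in> Mor G. (f \<oplus>\<^bsub>R\<^esub> g) s \<noteq> \<zero>\<^bsub>A (Cod G s)\<^esub>} \<subseteq>
      {s \<in> Mor G. f s \<noteq> \<zero>\<^bsub>A (Cod G s)\<^esub>} \<union> {s \<in> Mor G. g s \<noteq> \<zero>\<^bsub>A (Cod G s)\<^esub>}"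
    proof safe
      fix s assume s: "s \<in> Mor G" "(f \<oplus>\<^bsub>R\<^esub> g) s \<noteq> \<zero>\<^bsub>A (Cod G s)\<^esub>"
        and "g s = \<zero>\<^bsub>A (Cod G s)\<^esub>" "f s = \<zero>\<^bsub>A (Cod G s)\<^esub>"
      interpret ring "A (Cod G s)" using ring_Cod s by blast
      show False using s \<open>f s = _\<close> \<open>g s = _\<close> by (simp add: add_eval)
    qed
  qed (use assms finite_support in simp)
  moreover have "f \<oplus>\<^bsub>R\<^esub> g \<in> (\<Pi>\<^sub>E s\<in>Mor G. carrier (A (Cod G s)))"
  proof (rule PiE_I)
    fix s assume s: "s \<in> Mor G"
    interpret ring "A (Cod G s)" using ring_Cod s by blast
    show "(f \<oplus>\<^bsub>R\<^esub> g) s \<in> carrier (A (Cod G s))"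
      using s assms coeff_closed by (simp add: add_eval)
  qed (simp add: crossed_product_def)
  ultimately show ?thesis by (simp add: crossed_product_def)
qed

lemma crossed_product_l_distr:
  assumes f: "f \<in> carrier R" and g: "g \<in> carrier R" and h: "h \<in> carrier R"
  shows "(f \<oplus>\<^bsub>R\<^esub> g) \<otimes>\<^bsub>R\<^esub> h = f \<otimes>\<^bsub>R\<^esub> h \<oplus>\<^bsub>R\<^esub> g \<otimes>\<^bsub>R\<^esub> h"
proof (rule extensionalityI[of _ "Mor G"])
  fix r assume r: "r \<in> Mor G"
  interpret ring "A (Cod G r)" using ring_Cod r by blast
  let ?supp = "\<lambda>f. {s \<in> Mor G. f s \<noteq> \<zero>\<^bsub>A (Cod G s)\<^esub>}"
  let ?S = "?supp f \<union> ?supp g \<union> ?supp (f \<oplus>\<^bsub>R\<^esub> g)"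
  define J where "J = {(s, t) \<in> composable_pairs G. Comp G s t = r \<and> s \<in> ?S \<and> t \<in> ?supp h}"
  define F where "F = (\<lambda>f (s, t). f s \<otimes>\<^bsub>A (Cod G s)\<^esub> \<sigma> s (h t) \<otimes>\<^bsub>A (Cod G s)\<^esub> \<alpha> s t)"
  have fg: "f \<oplus>\<^bsub>R\<^esub> g \<in> carrier R" by (rule crossed_product_add_closed[OF f g])
  have S: "finite ?S" using finite_support f g fg by simp
  have T: "finite (?supp h)" using finite_support h by simp
  have C: "Cod G s = Cod G r" if "(s, t) \<in> composable_pairs G" "Comp G s t = r" for s t
    using Cod_Comp[of s t] that by (auto simp: composable_pairs_def)
  have cl: "F f \<in> J \<rightarrow> carrier (A (Cod G r))" if "f \<in> carrier R" for f
    using term_closed[OF _ that h] C by (fastforce simp: F_def J_def)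
  have "((f \<oplus>\<^bsub>R\<^esub> g) \<otimes>\<^bsub>R\<^esub> h) r = finsum (A (Cod G r)) (F (f \<oplus>\<^bsub>R\<^esub> g)) J"
    unfolding F_def J_def prod.case by (rule mult_eval[OF fg h r S _ T]) auto
  also have "\<dots> = finsum (A (Cod G r)) (\<lambda>i. F f i \<oplus>\<^bsub>A (Cod G r)\<^esub> F g i) J"
  proof (rule finsum_cong'[OF refl])
    show "(\<lambda>i. F f i \<oplus>\<^bsub>A (Cod G r)\<^esub> F g i) \<in> J \<rightarrow> carrier (A (Cod G r))"
      using cl[OF f] cl[OF g] by (simp add: Pi_iff)
    fix i assume "i \<in> J"
    moreover obtain s t where "i = (s, t)" by (cases i)
    ultimately have i: "i = (s, t)" "(s, t) \<in> composable_pairs G" "Comp G s t = r"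
      unfolding J_def by blast+
    have st: "s \<in> Mor G" "t \<in> Mor G" "Dom G s = Cod G t" "Cod G s = Cod G r"
      using C[OF i(2,3)] i(2) by (auto simp: composable_pairs_def)
    have "f s \<in> carrier (A (Cod G r))" "g s \<in> carrier (A (Cod G r))"
      "\<sigma> s (h t) \<in> carrier (A (Cod G r))" "\<alpha> s t \<in> carrier (A (Cod G r))"
      using coeff_closed[OF f st(1)] coeff_closed[OF g st(1)] coeff_closed[OF h st(2)]
        sigma_closed[OF st(1)] alpha_closed[OF i(2)] st by auto
    then show "F (f \<oplus>\<^bsub>R\<^esub> g) i = F f i \<oplus>\<^bsub>A (Cod G r)\<^esub> F g i"
      using i(1) st by (simp add: F_def add_eval l_distr)
  qed
  also have "\<dots> = finsum (A (Cod G r)) (F f) J \<oplus>\<^bsub>A (Cod G r)\<^esub> finsum (A (Cod G r)) (F g) J"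
    by (rule finsum_addf[OF cl[OF f] cl[OF g]])
  also have "finsum (A (Cod G r)) (F f) J = (f \<otimes>\<^bsub>R\<^esub> h) r"
    unfolding F_def J_def prod.case by (rule mult_eval[OF f h r S _ T, symmetric]) auto
  also have "finsum (A (Cod G r)) (F g) J = (g \<otimes>\<^bsub>R\<^esub> h) r"
    unfolding F_def J_def prod.case by (rule mult_eval[OF g h r S _ T, symmetric]) auto
  finally show "((f \<oplus>\<^bsub>R\<^esub> g) \<otimes>\<^bsub>R\<^esub> h) r = (f \<otimes>\<^bsub>R\<^esub> h \<oplus>\<^bsub>R\<^esub> g \<otimes>\<^bsub>R\<^esub> h) r"
    using r by (simp add: add_eval)
qed (simp_all add: crossed_product_def)

lemma crossed_product_r_distr:
  assumes f: "f \<in> carrier R" and g: "g \<in> carrier R" and h: "h \<in> carrier R"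
  shows "h \<otimes>\<^bsub>R\<^esub> (f \<oplus>\<^bsub>R\<^esub> g) = h \<otimes>\<^bsub>R\<^esub> f \<oplus>\<^bsub>R\<^esub> h \<otimes>\<^bsub>R\<^esub> g"
proof (rule extensionalityI[of _ "Mor G"])
  fix r assume r: "r \<in> Mor G"
  interpret ring "A (Cod G r)" using ring_Cod r by blast
  let ?supp = "\<lambda>f. {s \<in> Mor G. f s \<noteq> \<zero>\<^bsub>A (Cod G s)\<^esub>}"
  let ?T = "?supp f \<union> ?supp g \<union> ?supp (f \<oplus>\<^bsub>R\<^esub> g)"
  define J where "J = {(s, t) \<in> composable_pairs G. Comp G s t = r \<and> s \<in> ?supp h \<and> t \<in> ?T}"
  define F where "F = (\<lambda>f (s, t). h s \<otimes>\<^bsub>A (Cod G s)\<^esub> \<sigma> s (f t) \<otimes>\<^bsub>A (Cod G s)\<^esub> \<alpha> s t)"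
  have fg: "f \<oplus>\<^bsub>R\<^esub> g \<in> carrier R" by (rule crossed_product_add_closed[OF f g])
  have T: "finite ?T" using finite_support f g fg by simp
  have S: "finite (?supp h)" using finite_support h by simp
  have C: "Cod G s = Cod G r" if "(s, t) \<in> composable_pairs G" "Comp G s t = r" for s t
    using Cod_Comp[of s t] that by (auto simp: composable_pairs_def)
  have cl: "F f \<in> J \<rightarrow> carrier (A (Cod G r))" if "f \<in> carrier R" for f
    using term_closed[OF _ h that] C by (fastforce simp: F_def J_def)
  have "(h \<otimes>\<^bsub>R\<^esub> (f \<oplus>\<^bsub>R\<^esub> g)) r = finsum (A (Cod G r)) (F (f \<oplus>\<^bsub>R\<^esub> g)) J"
    unfolding F_def J_def prod.case by (rule mult_eval[OF h fg r S _ T]) auto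
  also have "\<dots> = finsum (A (Cod G r)) (\<lambda>i. F f i \<oplus>\<^bsub>A (Cod G r)\<^esub> F g i) J"
  proof (rule finsum_cong'[OF refl])
    show "(\<lambda>i. F f i \<oplus>\<^bsub>A (Cod G r)\<^esub> F g i) \<in> J \<rightarrow> carrier (A (Cod G r))"
      using cl[OF f] cl[OF g] by (simp add: Pi_iff)
    fix i assume "i \<in> J"
    moreover obtain s t where "i = (s, t)" by (cases i)
    ultimately have i: "i = (s, t)" "(s, t) \<in> composable_pairs G" "Comp G s t = r"
      unfolding J_def by blast+
    have st: "s \<in> Mor G" "t \<in> Mor G" "Dom G s = Cod G t" "Cod G s = Cod G r"
      using C[OF i(2,3)] i(2) by (auto simp: composable_pairs_def)
    have "\<sigma> s (f t) \<in> carrier (A (Cod G r))" "\<sigma> s (g t) \<in> carrier (A (Cod G r))"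
      "h s \<in> carrier (A (Cod G r))" "\<alpha> s t \<in> carrier (A (Cod G r))"
      using coeff_closed[OF f st(2)] coeff_closed[OF g st(2)] coeff_closed[OF h st(1)]
        sigma_closed[OF st(1)] alpha_closed[OF i(2)] st by auto
    moreover have "\<sigma> s ((f \<oplus>\<^bsub>R\<^esub> g) t) = \<sigma> s (f t) \<oplus>\<^bsub>A (Cod G r)\<^esub> \<sigma> s (g t)"
      using sigma_add[OF st(1), of "f t" "g t"] coeff_closed[OF f st(2)] coeff_closed[OF g st(2)] st
      by (simp add: add_eval)
    ultimately show "F (f \<oplus>\<^bsub>R\<^esub> g) i = F f i \<oplus>\<^bsub>A (Cod G r)\<^esub> F g i"
      using i(1) st by (simp add: F_def l_distr r_distr)
  qed
  also have "\<dots> = finsum (A (Cod G r)) (F f) J \<oplus>\<^bsub>A (Cod G r)\<^esub> finsum (A (Cod G r)) (F g) J"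
    by (rule finsum_addf[OF cl[OF f] cl[OF g]])
  also have "finsum (A (Cod G r)) (F f) J = (h \<otimes>\<^bsub>R\<^esub> f) r"
    unfolding F_def J_def prod.case by (rule mult_eval[OF h f r S _ T, symmetric]) auto
  also have "finsum (A (Cod G r)) (F g) J = (h \<otimes>\<^bsub>R\<^esub> g) r"
    unfolding F_def J_def prod.case by (rule mult_eval[OF h g r S _ T, symmetric]) auto
  finally show "(h \<otimes>\<^bsub>R\<^esub> (f \<oplus>\<^bsub>R\<^esub> g)) r = (h \<otimes>\<^bsub>R\<^esub> f \<oplus>\<^bsub>R\<^esub> h \<otimes>\<^bsub>R\<^esub> g) r"
    using r by (simp add: add_eval)
qed (simp_all add: crossed_product_def)

lemma monomial_closed:
  assumes "s \<in> Mor G" "a \<in> carrier (A (Cod G s))"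
  shows "monomial A G s a \<in> carrier R"
proof -
  have "finite {r \<in> Mor G. monomial A G s a r \<noteq> \<zero>\<^bsub>A (Cod G r)\<^esub>}"
    by (rule finite_subset[of _ "{s}"]) (auto simp: monomial_def)
  moreover have "\<zero>\<^bsub>A (Cod G r)\<^esub> \<in> carrier (A (Cod G r))" if "r \<in> Mor G" for r
    using ring.ring_simprules(2)[OF ring_Cod[OF that]] .
  ultimately show ?thesis
    using assms by (auto simp: crossed_product_def monomial_def)
qed

lemma monomial_mult:
  assumes s: "s \<in> Mor G" and t: "t \<in> Mor G"
    and a: "a \<in> carrier (A (Cod G s))" and b: "b \<in> carrier (A (Cod G t))"
  shows "monomial A G s a \<otimes>\<^bsub>R\<^esub> monomial A G t b =
    (if Dom G s = Cod G t
     then monomial A G (Comp G s t) (a \<otimes>\<^bsub>A (Cod G s)\<^esub> \<sigma> s b \<otimes>\<^bsub>A (Cod G s)\<^esub> \<alpha> s t)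
     else \<zero>\<^bsub>R\<^esub>)" (is "_ = ?m")
proof (rule extensionalityI[of _ "Mor G"])
  fix r assume r: "r \<in> Mor G"
  interpret ring "A (Cod G r)" using ring_Cod r by blast
  let ?f = "monomial A G s a" and ?g = "monomial A G t b"
  let ?F = "\<lambda>(s, t). ?f s \<otimes>\<^bsub>A (Cod G s)\<^esub> \<sigma> s (?g t) \<otimes>\<^bsub>A (Cod G s)\<^esub> \<alpha> s t"
  let ?J = "{(x, y) \<in> composable_pairs G. Comp G x y = r \<and> x \<in> {s} \<and> y \<in> {t}}"
  have f: "?f \<in> carrier R" and g: "?g \<in> carrier R" using assms by (simp_all add: monomial_closed)
  have e: "(?f \<otimes>\<^bsub>R\<^esub> ?g) r = finsum (A (Cod G r)) ?F ?J"
    by (rule mult_eval[OF f g r]) (auto simp: monomial_def split: if_splits)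
  show "(?f \<otimes>\<^bsub>R\<^esub> ?g) r = ?m r"
  proof (cases "Dom G s = Cod G t \<and> Comp G s t = r")
    case True
    then have J: "?J = {(s, t)}" and c: "(s, t) \<in> composable_pairs G"
      using s t by (auto simp: composable_pairs_def)
    have C: "Cod G s = Cod G r" using Cod_Comp[OF s t] True by simp
    have "finsum (A (Cod G r)) ?F {(s, t)} = ?F (s, t)"
      using term_closed[OF c f g] C by (simp add: finsum_insert)
    then show ?thesis using e J True r s t by (simp add: monomial_def)
  next
    case False
    then have "?J = {}" by (auto simp: composable_pairs_def)
    then have "(?f \<otimes>\<^bsub>R\<^esub> ?g) r = \<zero>\<^bsub>A (Cod G r)\<^esub>" using e by (simp only: finsum_empty)
    then show ?thesis using False r by (auto simp: monomial_def crossed_product_def)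
  qed
qed (auto simp: crossed_product_def monomial_def)

end

end

theory Submission
  imports Defs
begin

text \<open>The proof compares coefficients. Let \<open>g = \<Sum>\<^sub>e g\<^sub>e u\<^sub>e\<close> lie in the coefficient ring. Since \<open>u\<^sub>e\<close> is
  attached to an identity, multiplying a term \<open>a\<^sub>s u\<^sub>s\<close> by \<open>g\<close> on either side gives a multiple of
  the same \<open>u\<^sub>s\<close>, and only one object contributes: \<open>e = d(s)\<close> on the right, \<open>e = c(s)\<close> on the left.
  The normalisations of \<open>\<alpha>\<close> and \<open>\<sigma>\<close> at identities then give \<open>(f g)\<^sub>s = f\<^sub>s \<sigma>\<^sub>s(g\<^bsub>d(s)\<^esub>)\<close> and
  \<open>(g f)\<^sub>s = g\<^bsub>c(s)\<^esub> f\<^sub>s\<close>, which are \<open>mult_coefficient_ring_right\<close> and \<open>mult_coefficient_ring_left\<close>.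
  Thus \<open>f\<close> is in the commutant iff \<open>f\<^sub>s \<sigma>\<^sub>s(g\<^bsub>d(s)\<^esub>) = g\<^bsub>c(s)\<^esub> f\<^sub>s\<close> for all \<open>s\<close> and \<open>g\<close>.

  If \<open>d(s) = c(s)\<close>, the entry \<open>g\<^bsub>d(s)\<^esub>\<close> is an arbitrary element \<open>a\<close> of \<open>A\<^bsub>d(s)\<^esub>\<close>, and this is the
  second condition. If \<open>d(s) \<noteq> c(s)\<close>, the two entries can be chosen independently: the choice
  \<open>g\<^bsub>d(s)\<^esub> = 0\<close>, \<open>g\<^bsub>c(s)\<^esub> = 1\<close> forces \<open>f\<^sub>s = 0\<close>, and conversely \<open>f\<^sub>s = 0\<close> makes both sides vanish.\<close>

context crossed_system
begin

lemma coefficient_ring_closed: "g \<in> coefficient_ring A G \<sigma> \<alpha> \<Longrightarrow> g \<in> carrier R"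
  by (simp add: coefficient_ring_def)

lemma coefficient_ring_support:
  assumes "g \<in> coefficient_ring A G \<sigma> \<alpha>" "s \<in> Mor G" "g s \<noteq> \<zero>\<^bsub>A (Cod G s)\<^esub>"
  shows "s \<in> Ob G"
  using assms by (auto simp: coefficient_ring_def)

lemma monomial_in_coefficient_ring:
  assumes "e \<in> Ob G" "a \<in> carrier (A e)"
  shows "monomial A G e a \<in> coefficient_ring A G \<sigma> \<alpha>"
  using assms monomial_closed[of e a]
  by (auto simp: coefficient_ring_def monomial_def Ob_def)

lemma mult_coefficient_ring_right:
  assumes f: "f \<in> carrier R" and g: "g \<in> coefficient_ring A G \<sigma> \<alpha>" and r: "r \<in> Mor G"
  shows "(f \<otimes>\<^bsub>R\<^esub> g) r = f r \<otimes>\<^bsub>A (Cod G r)\<^esub> \<sigma> r (g (Dom G r))"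
proof -
  interpret ring "A (Cod G r)" using ring_Cod r by blast
  have gR: "g \<in> carrier R" by (rule coefficient_ring_closed[OF g])
  \<comment> \<open>Adjoining \<open>r\<close> and \<open>d(r)\<close> to the supports makes the index set a singleton even when
    \<open>f\<^sub>r\<close> or \<open>g\<^bsub>d(r)\<^esub>\<close> vanishes.\<close>
  let ?S = "insert r {s \<in> Mor G. f s \<noteq> \<zero>\<^bsub>A (Cod G s)\<^esub>}"
  let ?T = "insert (Dom G r) {t \<in> Mor G. g t \<noteq> \<zero>\<^bsub>A (Cod G t)\<^esub>}"
  let ?F = "\<lambda>(s, t). f s \<otimes>\<^bsub>A (Cod G s)\<^esub> \<sigma> s (g t) \<otimes>\<^bsub>A (Cod G s)\<^esub> \<alpha> s t"
  have pair: "(r, Dom G r) \<in> composable_pairs G"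
    using r by (simp add: composable_pairs_def Dom_Mor Cod_Dom)
  have "?T \<subseteq> Ob G"
    using coefficient_ring_support[OF g] r Dom_Ob by auto
  then have J: "{(s, t) \<in> composable_pairs G. Comp G s t = r \<and> s \<in> ?S \<and> t \<in> ?T} = {(r, Dom G r)}"
    using pair r by (fastforce simp: composable_pairs_def Ob_def Comp_Dom)
  have "(f \<otimes>\<^bsub>R\<^esub> g) r = finsum (A (Cod G r)) ?F {(r, Dom G r)}"
    unfolding J[symmetric]
    by (rule mult_eval[OF f gR r]) (use finite_support f gR in auto)
  also have "\<dots> = f r \<otimes>\<^bsub>A (Cod G r)\<^esub> \<sigma> r (g (Dom G r)) \<otimes>\<^bsub>A (Cod G r)\<^esub> \<alpha> r (Dom G r)"
    using term_closed[OF pair f gR] by (simp add: finsum_insert)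
  also have "\<dots> = f r \<otimes>\<^bsub>A (Cod G r)\<^esub> \<sigma> r (g (Dom G r))"
    using coeff_closed[OF f r] coeff_closed[OF gR Dom_Mor[OF r]] sigma_closed[OF r]
    by (simp add: alpha_Dom r Cod_Dom)
  finally show ?thesis .
qed

lemma mult_coefficient_ring_left:
  assumes f: "f \<in> carrier R" and g: "g \<in> coefficient_ring A G \<sigma> \<alpha>" and r: "r \<in> Mor G"
  shows "(g \<otimes>\<^bsub>R\<^esub> f) r = g (Cod G r) \<otimes>\<^bsub>A (Cod G r)\<^esub> f r"
proof -
  interpret ring "A (Cod G r)" using ring_Cod r by blast
  have gR: "g \<in> carrier R" by (rule coefficient_ring_closed[OF g])
  let ?S = "insert (Cod G r) {s \<in> Mor G. g s \<noteq> \<zero>\<^bsub>A (Cod G s)\<^esub>}"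
  let ?T = "insert r {t \<in> Mor G. f t \<noteq> \<zero>\<^bsub>A (Cod G t)\<^esub>}"
  let ?F = "\<lambda>(s, t). g s \<otimes>\<^bsub>A (Cod G s)\<^esub> \<sigma> s (f t) \<otimes>\<^bsub>A (Cod G s)\<^esub> \<alpha> s t"
  have pair: "(Cod G r, r) \<in> composable_pairs G"
    using r by (simp add: composable_pairs_def Cod_Mor Dom_Cod)
  have "?S \<subseteq> Ob G"
    using coefficient_ring_support[OF g] r Cod_Ob by auto
  then have J: "{(s, t) \<in> composable_pairs G. Comp G s t = r \<and> s \<in> ?S \<and> t \<in> ?T} = {(Cod G r, r)}"
    using pair r by (fastforce simp: composable_pairs_def Ob_def Comp_Cod)
  have "(g \<otimes>\<^bsub>R\<^esub> f) r = finsum (A (Cod G r)) ?F {(Cod G r, r)}"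
    unfolding J[symmetric]
    by (rule mult_eval[OF gR f r]) (use finite_support f gR in auto)
  also have "\<dots> = g (Cod G r) \<otimes>\<^bsub>A (Cod G r)\<^esub> \<sigma> (Cod G r) (f r) \<otimes>\<^bsub>A (Cod G r)\<^esub> \<alpha> (Cod G r) r"
    using term_closed[OF pair gR f] r by (simp add: finsum_insert Cod_Cod)
  also have "\<dots> = g (Cod G r) \<otimes>\<^bsub>A (Cod G r)\<^esub> f r"
    using coeff_closed[OF f r] coeff_closed[OF gR Cod_Mor[OF r]]
    by (simp add: alpha_Cod sigma_id Cod_Ob Cod_Cod r)
  finally show ?thesis .
qed

lemma commutes_with_coefficient_iff:
  assumes f: "f \<in> carrier R" and g: "g \<in> coefficient_ring A G \<sigma> \<alpha>"
  shows "f \<otimes>\<^bsub>R\<^esub> g = g \<otimes>\<^bsub>R\<^esub> f \<longleftrightarrow>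
    (\<forall>s\<in>Mor G. f s \<otimes>\<^bsub>A (Cod G s)\<^esub> \<sigma> s (g (Dom G s)) = g (Cod G s) \<otimes>\<^bsub>A (Cod G s)\<^esub> f s)"
proof -
  have "f \<otimes>\<^bsub>R\<^esub> g \<in> extensional (Mor G)" "g \<otimes>\<^bsub>R\<^esub> f \<in> extensional (Mor G)"
    by (simp_all add: crossed_product_def)
  then have "f \<otimes>\<^bsub>R\<^esub> g = g \<otimes>\<^bsub>R\<^esub> f \<longleftrightarrow> (\<forall>s\<in>Mor G. (f \<otimes>\<^bsub>R\<^esub> g) s = (g \<otimes>\<^bsub>R\<^esub> f) s)"
    by (metis extensionalityI)
  then show ?thesis
    by (simp add: mult_coefficient_ring_right[OF f g] mult_coefficient_ring_left[OF f g])
qed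

text \<open>Monomials at objects are enough test elements: at \<open>c(s)\<close> with coefficient \<open>1\<close> when
  \<open>d(s) \<noteq> c(s)\<close>, and at \<open>d(s) = c(s)\<close> with coefficient \<open>a\<close> otherwise.\<close>

lemma commutant_coefficient_ring_iff:
  assumes f: "f \<in> carrier R"
  shows "(\<forall>g\<in>coefficient_ring A G \<sigma> \<alpha>. f \<otimes>\<^bsub>R\<^esub> g = g \<otimes>\<^bsub>R\<^esub> f) \<longleftrightarrow>
    (\<forall>s\<in>Mor G. Dom G s \<noteq> Cod G s \<longrightarrow> f s = \<zero>\<^bsub>A (Cod G s)\<^esub>) \<and>
    (\<forall>s\<in>Mor G. Dom G s = Cod G s \<longrightarrow>
      (\<forall>a\<in>carrier (A (Dom G s)). f s \<otimes>\<^bsub>A (Cod G s)\<^esub> \<sigma> s a = a \<otimes>\<^bsub>A (Cod G s)\<^esub> f s))"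
    (is "?commutes \<longleftrightarrow> ?vanishes \<and> ?twisted")
proof
  assume comm: ?commutes
  have test: "f s \<otimes>\<^bsub>A (Cod G s)\<^esub> \<sigma> s (monomial A G (Cod G s) a (Dom G s)) =
      a \<otimes>\<^bsub>A (Cod G s)\<^esub> f s"
    if s: "s \<in> Mor G" and a: "a \<in> carrier (A (Cod G s))" for s a
  proof -
    have m: "monomial A G (Cod G s) a \<in> coefficient_ring A G \<sigma> \<alpha>"
      by (rule monomial_in_coefficient_ring[OF Cod_Ob[OF s] a])
    show ?thesis
      using comm m commutes_with_coefficient_iff[OF f m] s Cod_Mor[OF s]
      by (auto simp: monomial_def)
  qed
  show "?vanishes \<and> ?twisted"
  proof (intro conjI ballI impI)
    fix s assume s: "s \<in> Mor G" and ne: "Dom G s \<noteq> Cod G s"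
    interpret ring "A (Cod G s)" using ring_Cod s by blast
    have fs: "f s \<in> carrier (A (Cod G s))" by (rule coeff_closed[OF f s])
    have "monomial A G (Cod G s) \<one>\<^bsub>A (Cod G s)\<^esub> (Dom G s) = \<zero>\<^bsub>A (Dom G s)\<^esub>"
      using s ne by (simp add: monomial_def Dom_Mor Cod_Dom)
    then show "f s = \<zero>\<^bsub>A (Cod G s)\<^esub>"
      using test[OF s one_closed] s fs by (simp add: sigma_zero)
  next
    fix s a assume s: "s \<in> Mor G" and eq: "Dom G s = Cod G s" and a: "a \<in> carrier (A (Dom G s))"
    show "f s \<otimes>\<^bsub>A (Cod G s)\<^esub> \<sigma> s a = a \<otimes>\<^bsub>A (Cod G s)\<^esub> f s"
      using test[OF s, of a] a eq Cod_Mor[OF s] by (simp add: monomial_def)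
  qed
next
  assume cond: "?vanishes \<and> ?twisted"
  show ?commutes
  proof
    fix g assume g: "g \<in> coefficient_ring A G \<sigma> \<alpha>"
    have "f s \<otimes>\<^bsub>A (Cod G s)\<^esub> \<sigma> s (g (Dom G s)) = g (Cod G s) \<otimes>\<^bsub>A (Cod G s)\<^esub> f s"
      if s: "s \<in> Mor G" for s
    proof -
      interpret ring "A (Cod G s)" using ring_Cod s by blast
      have gd: "g (Dom G s) \<in> carrier (A (Dom G s))" and gc: "g (Cod G s) \<in> carrier (A (Cod G s))"
        using coeff_closed[OF coefficient_ring_closed[OF g]] Dom_Mor[OF s] Cod_Mor[OF s]
          Cod_Dom[OF s] Cod_Cod[OF s] by metis+
      show ?thesis
      proof (cases "Dom G s = Cod G s")
        case True
        then show ?thesis using cond s gd by auto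
      next
        case False
        then have "f s = \<zero>\<^bsub>A (Cod G s)\<^esub>" using cond s by blast
        then show ?thesis using sigma_closed[OF s gd] gc by simp
      qed
    qed
    then show "f \<otimes>\<^bsub>R\<^esub> g = g \<otimes>\<^bsub>R\<^esub> f"
      by (simp add: commutes_with_coefficient_iff[OF f g])
  qed
qed

end

theorem proposition4:
  fixes A :: "'g \<Rightarrow> 'a ring" and G :: "'g category"
    and \<sigma> :: "'g \<Rightarrow> 'a \<Rightarrow> 'a" and \<alpha> :: "'g \<Rightarrow> 'g \<Rightarrow> 'a"
  assumes "crossed_system A G \<sigma> \<alpha>"
  shows "commutant (crossed_product A G \<sigma> \<alpha>) (coefficient_ring A G \<sigma> \<alpha>) =
    {f \<in> carrier (crossed_product A G \<sigma> \<alpha>).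
      (\<forall>s\<in>Mor G. Dom G s \<noteq> Cod G s \<longrightarrow> f s = \<zero>\<^bsub>A (Cod G s)\<^esub>) \<and>
      (\<forall>s\<in>Mor G. Dom G s = Cod G s \<longrightarrow>
        (\<forall>a\<in>carrier (A (Dom G s)).
          f s \<otimes>\<^bsub>A (Cod G s)\<^esub> \<sigma> s a = a \<otimes>\<^bsub>A (Cod G s)\<^esub> f s))}"
  unfolding commutant_def
  using crossed_system.commutant_coefficient_ring_iff[OF assms]
  by (intro Collect_cong conj_cong refl)

end
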